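(* Let $n \ge 1$ and $0 \le \tau \le n-1$ be integers, and let $\{p(\tau)\}_n$ denote the number of partitions of $n$ whose largest part equals $n-\tau$. Set $\lambda = 2\tau - n$ if $2\tau - n > 0$ and $\lambda = 0$ if $2\tau - n \le 0$. Then $$\{p(\tau)\}_n \;=\; p(\tau) \;-\; \sum_{i=0}^{\lambda-1} \{p(i)\}_{\tau},$$ where the sum is empty when $\lambda = 0$. In other words, the term $\{p(\tau)\}_n$ has exactly $\lambda = \max(2\tau-n,0)$ subtracted terms, namely $\{p(0)\}_\tau, \{p(1)\}_\tau, \dots, \{p(\lambda-1)\}_\tau$.
   Context: $p(m)$ denotes the number of partitions of the integer $m$, with the conventions $p(0)=1$ and $p(m)=0$ for $m<0$. The paper writes $p(n)=\sum_{i=0}^{n-1}\{p(i)\}$, where the term $\{p(i)\}$ is the number of partitions of $n$ whose largest part is $n-i$. In the paper's terminology, $\{p(\tau)\}$ is a "parcel" whose "father-parcel" is $p(n)$. The parcel is written as $p(\tau)$ minus its "child-parcels" $\{p(0)\},\dots,\{p(\lambda-1)\}$, and each child-parcel $\{p(i)\}$ is taken relative to $\tau$, i.e. it is the number of partitions of $\tau$ whose largest part is $\tau-i$. This rigorous reading of the paper's informal parcel/cell statement is the one confirmed by the paper's worked expansion of $p(10)$. *)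

theory Defs
  imports Complex_Main "HOL-Library.Multiset"
begin

text \<open>
  The argument is an integer, so that the convention \<open>p(m) = 0\<close> for \<open>m < 0\<close>
  is covered (there are no such partitions) and no truncated subtraction occurs.
\<close>

definition partitions :: "int \<Rightarrow> nat multiset set" where
  "partitions m = {A. 0 \<notin># A \<and> int (sum_mset A) = m}"

definition num_partitions :: "int \<Rightarrow> nat" where
  "num_partitions m = card (partitions m)"

text \<open>
  \<open>parcel n t\<close> is \<open>{p(t)}\<^sub>n\<close>, the number of partitions of \<open>n\<close> with largest part \<open>n - t\<close>.
  The empty partition has no largest part (\<open>Max\<close> is unspecified on it), hence it is excluded.
\<close>

definition parcel :: "int \<Rightarrow> int \<Rightarrow> nat" where
  "parcel n t = card {A \<in> partitions n. A \<noteq> {#} \<and> int (Max (set_mset A)) = n - t}"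

lemma finite_partitions: "finite (partitions m)"
proof -
  have size_le: "size A \<le> sum_mset A" if "0 \<notin># A" for A :: "nat multiset"
    using that by (induction A) auto
  have "partitions m \<subseteq> mset ` {xs. set xs \<subseteq> {..nat m} \<and> length xs \<le> nat m}"
  proof
    fix A assume "A \<in> partitions m"
    hence A: "0 \<notin># A" "sum_mset A = nat m" by (auto simp: partitions_def simp del: of_nat_sum_mset)
    obtain xs where xs: "mset xs = A" using ex_mset by blast
    have "x \<le> nat m" if "x \<in># A" for x
      using that A(2) by (metis le_add1 multi_member_split sum_mset.add_mset)
    hence "set xs \<subseteq> {..nat m}" using xs by auto
    moreover have "length xs \<le> nat m" using size_le[OF A(1)] A(2) xs by auto
    ultimately show "A \<in> mset ` {xs. set xs \<subseteq> {..nat m} \<and> length xs \<le> nat m}"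
      using xs by blast
  qed
  thus ?thesis
    by (rule finite_subset) (intro finite_imageI finite_lists_length_le finite_atMost)
qed

lemma num_partitions_neg: "m < 0 \<Longrightarrow> num_partitions m = 0"
  proof -
  assume "m < 0"
  hence "partitions m = {}" by (auto simp: partitions_def simp del: of_nat_sum_mset)
  thus ?thesis by (simp add: num_partitions_def)
qed

lemma num_partitions_0: "num_partitions 0 = 1"
proof -
  have "A = {#}" if "0 \<notin># A" "sum_mset A = 0" for A :: "nat multiset"
    using that by (cases A) auto
  hence "partitions 0 = {{#}}" by (auto simp: partitions_def simp del: of_nat_sum_mset sum_mset_0_iff)
  thus ?thesis by (simp add: num_partitions_def)
qed

end

theory Submission
  imports Defs
begin

text \<open>
  Removing one copy of the largest part \<open>n - \<tau>\<close> turns the partitions counted by \<open>{p(\<tau>)}\<^sub>n\<close>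
  into the partitions of \<open>\<tau>\<close> with all parts at most \<open>n - \<tau>\<close>. The remaining partitions of \<open>\<tau>\<close>
  have a largest part \<open>\<tau> - i > n - \<tau>\<close>, that is, \<open>0 \<le> i < 2\<tau> - n\<close>, and are classified by \<open>i\<close>.
\<close>

definition bounded_partitions :: "int \<Rightarrow> int \<Rightarrow> nat multiset set" where
  "bounded_partitions m b = {A \<in> partitions m. \<forall>x\<in>#A. int x \<le> b}"

definition partitions_with_max :: "int \<Rightarrow> int \<Rightarrow> nat multiset set" where
  "partitions_with_max m k = {A \<in> partitions m. A \<noteq> {#} \<and> int (Max (set_mset A)) = k}"

lemma parcel_eq_card_partitions_with_max: "parcel n t = card (partitions_with_max n (n - t))"
  by (simp add: parcel_def partitions_with_max_def)

lemma finite_bounded_partitions: "finite (bounded_partitions m b)"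
  by (simp add: bounded_partitions_def finite_partitions)

lemma finite_partitions_with_max: "finite (partitions_with_max m k)"
  by (simp add: partitions_with_max_def finite_partitions)

lemma add_mset_in_partitions_iff:
  "add_mset k A \<in> partitions m \<longleftrightarrow> k > 0 \<and> A \<in> partitions (m - int k)"
  by (auto simp: partitions_def simp del: of_nat_sum_mset)

lemma add_mset_in_bounded_partitions_iff:
  "add_mset k A \<in> bounded_partitions m b \<longleftrightarrow>
    0 < k \<and> int k \<le> b \<and> A \<in> bounded_partitions (m - int k) b"
  by (auto simp: bounded_partitions_def add_mset_in_partitions_iff)

lemma bounded_partitions_self: "bounded_partitions m m = partitions m"
proof -
  have "int x \<le> m" if "A \<in> partitions m" and "x \<in># A" for A x
  proof -
    from \<open>x \<in># A\<close> obtain B where "A = add_mset x B" by (rule mset_add)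
    with \<open>A \<in> partitions m\<close> show ?thesis
      by (auto simp: partitions_def simp del: of_nat_sum_mset)
  qed
  then show ?thesis by (auto simp: bounded_partitions_def)
qed

lemma partitions_with_max_iff:
  "A \<in> partitions_with_max m (int k) \<longleftrightarrow> k \<in># A \<and> A \<in> bounded_partitions m (int k)"
  by (auto simp: partitions_with_max_def bounded_partitions_def intro: Max_in Max_eqI)

lemma partitions_with_max_eq_image_add_mset:
  assumes "k > 0"
  shows "partitions_with_max m (int k) = add_mset k ` bounded_partitions (m - int k) (int k)"
proof (intro set_eqI)
  fix A
  have "A \<in> partitions_with_max m (int k) \<longleftrightarrow>
      (\<exists>B. A = add_mset k B \<and> add_mset k B \<in> bounded_partitions m (int k))"
    by (auto simp: partitions_with_max_iff dest: multi_member_split)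
  also have "\<dots> \<longleftrightarrow> A \<in> add_mset k ` bounded_partitions (m - int k) (int k)"
    using assms by (auto simp: add_mset_in_bounded_partitions_iff)
  finally show "A \<in> partitions_with_max m (int k) \<longleftrightarrow>
      A \<in> add_mset k ` bounded_partitions (m - int k) (int k)" .
qed

lemma card_partitions_with_max:
  assumes "k > 0"
  shows "card (partitions_with_max m k) = card (bounded_partitions (m - k) k)"
proof -
  from assms obtain j where "j > 0" and "k = int j" by (metis zero_less_imp_eq_int)
  then show ?thesis
    by (simp add: partitions_with_max_eq_image_add_mset card_image inj_on_def)
qed

lemma partitions_eq_bounded_Un_with_max:
  "partitions m = bounded_partitions m b \<union> (\<Union>k\<in>{b<..m}. partitions_with_max m k)"
proof (intro equalityI subsetI)
  fix A assume A: "A \<in> partitions m"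
  show "A \<in> bounded_partitions m b \<union> (\<Union>k\<in>{b<..m}. partitions_with_max m k)"
  proof (cases "A \<in> bounded_partitions m b")
    case False
    then obtain x where "x \<in># A" and "b < int x"
      using A by (auto simp: bounded_partitions_def)
    define k where "k = Max (set_mset A)"
    have "k \<in># A" and "x \<le> k"
      using \<open>x \<in># A\<close> by (auto simp: k_def intro: Max_in)
    moreover have "int k \<le> m"
      using A \<open>k \<in># A\<close> bounded_partitions_self[of m] by (auto simp: bounded_partitions_def)
    ultimately have "int k \<in> {b<..m}" using \<open>b < int x\<close> by simp
    moreover have "A \<in> partitions_with_max m (int k)"
      using A \<open>x \<in># A\<close> by (auto simp: partitions_with_max_def k_def)
    ultimately show ?thesis by blast
  qed simp
qed (auto simp: bounded_partitions_def partitions_with_max_def)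

lemma bounded_partitions_disjoint_with_max:
  assumes "b < k"
  shows "bounded_partitions m b \<inter> partitions_with_max m k = {}"
proof -
  have "A \<notin> bounded_partitions m b" if "A \<in> partitions_with_max m k" for A
  proof -
    from that obtain j where "k = int j" by (auto simp: partitions_with_max_def)
    with that have "j \<in># A" by (simp add: partitions_with_max_iff)
    with \<open>k = int j\<close> assms show ?thesis by (force simp: bounded_partitions_def)
  qed
  then show ?thesis by blast
qed

lemma num_partitions_eq_bounded_plus_sum_with_max:
  "num_partitions m =
    card (bounded_partitions m b) + (\<Sum>k\<in>{b<..m}. card (partitions_with_max m k))"
proof -
  let ?U = "\<Union>k\<in>{b<..m}. partitions_with_max m k"
  have "num_partitions m = card (bounded_partitions m b \<union> ?U)"
    by (simp add: num_partitions_def flip: partitions_eq_bounded_Un_with_max)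
  also have "\<dots> = card (bounded_partitions m b) + card ?U"
    using bounded_partitions_disjoint_with_max[of b _ m]
    by (intro card_Un_disjoint)
      (auto simp: finite_bounded_partitions finite_partitions_with_max Int_UN_distrib)
  also have "card ?U = (\<Sum>k\<in>{b<..m}. card (partitions_with_max m k))"
    by (intro card_UN_disjoint)
      (use finite_partitions_with_max in \<open>auto simp: partitions_with_max_def\<close>)
  finally show ?thesis .
qed

theorem mainTheorem1:
  fixes n \<tau> lam :: int
  assumes "n \<ge> 1" and "0 \<le> \<tau>" and "\<tau> \<le> n - 1"
    and "lam = (if 2 * \<tau> - n > 0 then 2 * \<tau> - n else 0)"
  shows "int (parcel n \<tau>) = int (num_partitions \<tau>) - (\<Sum>i = 0..lam - 1. int (parcel \<tau> i))"
proof -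
  have parcel_n: "parcel n \<tau> = card (bounded_partitions \<tau> (n - \<tau>))"
    using assms(3) card_partitions_with_max[of "n - \<tau>" n]
    by (simp add: parcel_eq_card_partitions_with_max)
  have "(\<Sum>i = 0..lam - 1. parcel \<tau> i) =
      (\<Sum>k\<in>{n - \<tau><..\<tau>}. card (partitions_with_max \<tau> k))"
    unfolding parcel_eq_card_partitions_with_max
    by (rule sum.reindex_bij_witness[of _ "\<lambda>k. \<tau> - k" "\<lambda>i. \<tau> - i"])
      (use assms(4) in \<open>auto split: if_splits\<close>)
  then have "num_partitions \<tau> = parcel n \<tau> + (\<Sum>i = 0..lam - 1. parcel \<tau> i)"
    using num_partitions_eq_bounded_plus_sum_with_max[of \<tau> "n - \<tau>"] parcel_n by simp
  then show ?thesis by simp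
qed

end
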